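(* Let $n\ge 1$ and $M\ge 2$ be integers. Let $s\in(0,1]$ and assume that $m=1/s^2$ is a positive integer such that $m\le M/5$. Let $\mu_1,\dots,\mu_M\in\mathbb{R}^n$ satisfy $|\mu_j|_2=1$ for all $j=1,\dots,M$, and let $T$ be the convex hull of the $2M$ points $\{\pm\mu_1,\dots,\pm\mu_M\}$. Assume that for some real number $\kappa\in(0,1)$ we have $$\kappa|\theta|_2\le |\mu_\theta|_2\qquad\text{for all }\theta\in\mathbb{R}^M\text{ such that }|\theta|_0\le 2m,$$ where $\mu_\theta=\sum_{j=1}^M\theta_j\mu_j$. Then $$\ell(T\cap sB_2)\;\ge\;\frac{\sqrt 2}{4}\,\kappa\,\sqrt{\log\left(\frac{Ms^2}{5}\right)}.$$
   Context: $|\cdot|_2$ is the Euclidean norm and $|\theta|_0$ is the number of nonzero coordinates of $\theta$. $sB_2=\{u\in\mathbb{R}^n:|u|_2\le s\}$. For $S\subset\mathbb{R}^n$, the Gaussian width is $\ell(S)=\mathbb{E}\sup_{u\in S}u^Tg$, where $g$ is a centered Gaussian random vector in $\mathbb{R}^n$ with covariance matrix $I_{n\times n}$. *)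

theory Defs
  imports "HOL-Probability.Probability"
begin

definition std_gaussian :: "(real ^ 'n) measure" where
  "std_gaussian = density lborel (\<lambda>x. ennreal (\<Prod>i\<in>UNIV. std_normal_density (x $ i)))"

(* The supremum and the integral are real-valued, so this is the Gaussian width
   only for nonempty bounded S. *)
definition gaussian_width :: "(real ^ 'n) set \<Rightarrow> real" where
  "gaussian_width S = (\<integral>g. (SUP u\<in>S. u \<bullet> g) \<partial>std_gaussian)"

definition l0 :: "real ^ 'k \<Rightarrow> nat" where
  "l0 \<theta> = card {j. \<theta> $ j \<noteq> 0}"

definition lin_comb :: "('k \<Rightarrow> real ^ 'n) \<Rightarrow> real ^ 'k \<Rightarrow> real ^ 'n" where
  "lin_comb \<mu> \<theta> = (\<Sum>j\<in>UNIV. \<theta> $ j *\<^sub>R \<mu> j)"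

end

theory Submission imports Defs
begin

text \<open>The width of a set is at least the expected maximum of the Gaussian process
\<open>u \<bullet> g\<close> over any finite subset, and by Sudakov's principle that maximum is large as soon
as the subset is large and well separated. The proof combines such a subset with a
form of Sudakov's inequality whose constant is explicit.

The subset. Let \<open>F\<close> be a family of \<open>m\<close>-element index sets, any two of which share at
most \<open>m / 2\<close> indices; a maximal such family satisfies
\<open>ln (card F) \<ge> 2 ln 2 + (m / 2) ln (M / (5 m))\<close> by a Gilbert--Varshamov counting
argument (\<open>ex_large_packing\<close>). For each set \<open>S\<close> in \<open>F\<close> some choice of signs gives
\<open>|\<Sum>j\<in>S. \<sigma> j \<mu> j|\<^sup>2 \<le> m\<close>, since the average of this quantity over all signs is \<open>m\<close>
(\<open>ex_signs_norm_sum_le\<close>). Dividing by \<open>m = 1 / s\<^sup>2\<close> gives a convex combination of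
the points \<open>\<plusminus>\<mu> j\<close> of norm at most \<open>s\<close>. Two of the coefficient vectors differ in at least \<open>m\<close>
coordinates and their difference is \<open>2 m\<close>-sparse, so the restricted lower
bound separates the points by \<open>\<kappa> s\<close> (\<open>ex_separated_subset_of_hull\<close>).

Sudakov's inequality (\<open>sudakov_minoration\<close>). For \<open>N\<close> points with separation \<open>\<epsilon>\<close> let
\<open>\<psi> t\<close> be the expectation of \<open>ln (\<Sum>u. exp (t (u \<bullet> g)))\<close>. Its derivative is the expected
mean of \<open>u \<bullet> g\<close> under the Gibbs weights \<open>p\<close>. Gaussian integration by parts turns this
into \<open>t\<close> times the expected variance of \<open>u\<close> under \<open>p\<close>, which is at least
\<open>(\<epsilon>\<^sup>2 / 2) E (1 - \<Sum> p\<^sup>2)\<close>. On the other hand \<open>\<psi> - t \<psi>'\<close> is the expected entropy of \<open>p\<close>, and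
the entropy is at most \<open>ln 2 + (1 - \<Sum> p\<^sup>2) ln N\<close>. Eliminating \<open>\<Sum> p\<^sup>2\<close> leaves, for
\<open>f = \<psi> - ln 2\<close> and \<open>a = \<epsilon>\<^sup>2 / (2 ln N)\<close>, the differential inequality
\<open>a t (f - t f') \<le> f'\<close>, whence \<open>f t \<ge> f 0 sqrt (1 + a t\<^sup>2)\<close>. Since \<open>\<psi> t \<le> ln N + t L\<close> with
\<open>L\<close> the expected supremum, letting \<open>t\<close> grow yields \<open>L \<ge> sqrt a (ln N - ln 2)\<close>.
The summand \<open>2 ln 2\<close> in the packing bound is what absorbs the loss \<open>ln 2\<close>
(\<open>half_sqrt_le_minoration\<close>).\<close>

section \<open>The Gaussian measure and its translates\<close>

definition gauss_density :: "real ^ 'n \<Rightarrow> real" where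
  "gauss_density x = (\<Prod>i\<in>UNIV. std_normal_density (x $ i))"

lemma gauss_density_nonneg: "0 \<le> gauss_density x"
  by (auto simp: gauss_density_def intro!: prod_nonneg)

lemma gauss_density_measurable [measurable]: "gauss_density \<in> borel_measurable borel"
  unfolding gauss_density_def by measurable

lemma std_gaussian_eq: "std_gaussian = density lborel (\<lambda>x. ennreal (gauss_density x))"
  by (simp add: std_gaussian_def gauss_density_def)

lemma sets_std_gaussian [measurable_cong, simp]: "sets std_gaussian = sets borel"
  by (simp add: std_gaussian_def)

lemma space_std_gaussian [simp]: "space std_gaussian = UNIV"
  by (simp add: std_gaussian_def)

lemma prob_space_std_gaussian: "prob_space (std_gaussian :: (real ^ 'n) measure)"
proof
  have "emeasure (std_gaussian :: (real ^ 'n) measure) (space std_gaussian)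
      = (\<integral>\<^sup>+ x. (\<Prod>i\<in>UNIV. ennreal (std_normal_density (x $ i))) \<partial>(lborel :: (real ^ 'n) measure))"
    by (simp add: std_gaussian_def emeasure_density prod_ennreal)
  also have "\<dots> = (\<integral>\<^sup>+ x. (\<Prod>b\<in>Basis. ennreal (std_normal_density (x \<bullet> b))) \<partial>(lborel :: (real ^ 'n) measure))"
  proof (rule nn_integral_cong)
    fix x :: "real ^ 'n"
    have B: "(Basis :: (real ^ 'n) set) = (\<lambda>i. axis i 1) ` UNIV"
      by (auto simp: Basis_vec_def)
    have "inj (\<lambda>i::'n. axis i (1::real))"
      by (auto simp: inj_on_def axis_eq_axis)
    then show "(\<Prod>i\<in>UNIV. ennreal (std_normal_density (x $ i)))
        = (\<Prod>b\<in>Basis. ennreal (std_normal_density (x \<bullet> b)))"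
      unfolding B by (subst prod.reindex) (auto simp: inner_axis)
  qed
  also have "\<dots> = (\<Prod>b\<in>(Basis :: (real ^ 'n) set). \<integral>\<^sup>+ y. ennreal (std_normal_density y) \<partial>lborel)"
    by (rule nn_integral_lborel_prod) auto
  also have "(\<integral>\<^sup>+ y. ennreal (std_normal_density y) \<partial>lborel) = 1"
    using prob_space.emeasure_space_1[OF prob_space_normal_density[of 1 0]]
    by (simp add: emeasure_density)
  finally show "emeasure (std_gaussian :: (real ^ 'n) measure) (space std_gaussian) = 1"
    by simp
qed

lemma measure_std_gaussian_UNIV [simp]: "measure (std_gaussian :: (real ^ 'n) measure) UNIV = 1"
  using prob_space.prob_space[OF prob_space_std_gaussian] by simp

lemma gauss_density_shift:
  fixes x v :: "real ^ 'n"
  shows "gauss_density (x - v) = gauss_density x * exp (x \<bullet> v - (norm v)\<^sup>2 / 2)"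
proof -
  have "std_normal_density (x $ i - v $ i) =
      std_normal_density (x $ i) * exp (x $ i * v $ i - (v $ i)\<^sup>2 / 2)" for i
    by (simp add: std_normal_density_def exp_add[symmetric] power2_eq_square field_simps)
  then have "gauss_density (x - v)
      = gauss_density x * exp (\<Sum>i\<in>UNIV. x $ i * v $ i - (v $ i)\<^sup>2 / 2)"
    by (simp add: gauss_density_def prod.distrib exp_sum)
  also have "(\<Sum>i\<in>UNIV. x $ i * v $ i - (v $ i)\<^sup>2 / 2) = x \<bullet> v - (norm v)\<^sup>2 / 2"
    unfolding power2_norm_eq_inner
    by (simp add: sum_subtractf inner_vec_def sum_divide_distrib power2_eq_square)
  finally show ?thesis .
qed

text \<open>The Cameron--Martin formula: translating the Gaussian measure multiplies it by an explicit
exponential factor, because Lebesgue measure is translation invariant. It yields the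
integrability of exponentials of linear functions as well as integration by parts.\<close>

lemma
  fixes F :: "real ^ 'n \<Rightarrow> real" and v :: "real ^ 'n"
  assumes [measurable]: "F \<in> borel_measurable borel"
  shows integrable_gaussian_shift:
      "integrable std_gaussian (\<lambda>x. F (x + v)) \<longleftrightarrow>
       integrable std_gaussian (\<lambda>x. F x * exp (x \<bullet> v - (norm v)\<^sup>2 / 2))"
    and integral_gaussian_shift:
      "(\<integral>x. F (x + v) \<partial>std_gaussian) =
       (\<integral>x. F x * exp (x \<bullet> v - (norm v)\<^sup>2 / 2) \<partial>std_gaussian)"
proof -
  let ?H = "\<lambda>x. gauss_density (x - v) * F x"
  have H: "?H = (\<lambda>x. gauss_density x * (F x * exp (x \<bullet> v - (norm v)\<^sup>2 / 2)))"
    by (simp add: gauss_density_shift fun_eq_iff)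
  have "integrable std_gaussian (\<lambda>x. F (x + v)) \<longleftrightarrow>
      integrable lborel (\<lambda>x. gauss_density x * F (x + v))"
    by (simp add: std_gaussian_eq integrable_density gauss_density_nonneg)
  also have "\<dots> \<longleftrightarrow> integrable (distr lborel borel ((+) v)) ?H"
    by (subst integrable_distr_eq) (auto simp: add.commute)
  also have "\<dots> \<longleftrightarrow> integrable lborel ?H"
    by (simp add: lborel_distr_plus)
  also have "\<dots> \<longleftrightarrow> integrable std_gaussian (\<lambda>x. F x * exp (x \<bullet> v - (norm v)\<^sup>2 / 2))"
    unfolding H by (simp add: std_gaussian_eq integrable_density gauss_density_nonneg)
  finally show "integrable std_gaussian (\<lambda>x. F (x + v)) \<longleftrightarrow>
       integrable std_gaussian (\<lambda>x. F x * exp (x \<bullet> v - (norm v)\<^sup>2 / 2))" .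
  have "(\<integral>x. F (x + v) \<partial>std_gaussian) = (\<integral>x. gauss_density x * F (x + v) \<partial>lborel)"
    by (simp add: std_gaussian_eq integral_density gauss_density_nonneg)
  also have "\<dots> = (\<integral>x. ?H x \<partial>distr lborel borel ((+) v))"
    by (subst integral_distr) (auto simp: add.commute)
  also have "\<dots> = (\<integral>x. ?H x \<partial>lborel)"
    by (simp add: lborel_distr_plus)
  also have "\<dots> = (\<integral>x. F x * exp (x \<bullet> v - (norm v)\<^sup>2 / 2) \<partial>std_gaussian)"
    unfolding H by (simp add: std_gaussian_eq integral_density gauss_density_nonneg)
  finally show "(\<integral>x. F (x + v) \<partial>std_gaussian) =
       (\<integral>x. F x * exp (x \<bullet> v - (norm v)\<^sup>2 / 2) \<partial>std_gaussian)" .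
qed

lemma integrable_gaussian_exp_inner:
  fixes v :: "real ^ 'n"
  shows "integrable std_gaussian (\<lambda>x. exp (x \<bullet> v))"
proof -
  interpret prob_space "std_gaussian :: (real ^ 'n) measure" by (rule prob_space_std_gaussian)
  have "integrable std_gaussian (\<lambda>x. 1 * exp (x \<bullet> v - (norm v)\<^sup>2 / 2))"
    by (subst integrable_gaussian_shift[symmetric]) auto
  then have "integrable std_gaussian (\<lambda>x. exp ((norm v)\<^sup>2 / 2) * (1 * exp (x \<bullet> v - (norm v)\<^sup>2 / 2)))"
    by (rule integrable_mult_right)
  then show ?thesis by (simp add: exp_add[symmetric])
qed

lemma integrable_gaussian_exp_abs_inner:
  fixes v :: "real ^ 'n"
  shows "integrable std_gaussian (\<lambda>x. exp (c * \<bar>x \<bullet> v\<bar>))"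
proof (rule Bochner_Integration.integrable_bound)
  show "integrable std_gaussian (\<lambda>x. exp (x \<bullet> (c *\<^sub>R v)) + exp (x \<bullet> (- c *\<^sub>R v)))"
    by (intro Bochner_Integration.integrable_add integrable_gaussian_exp_inner)
  show "AE x in std_gaussian. norm (exp (c * \<bar>x \<bullet> v\<bar>))
      \<le> norm (exp (x \<bullet> (c *\<^sub>R v)) + exp (x \<bullet> (- c *\<^sub>R v)))"
  proof (rule AE_I2)
    fix x :: "real ^ 'n"
    have "exp (c * \<bar>x \<bullet> v\<bar>) \<le> exp (c * (x \<bullet> v)) + exp (- (c * (x \<bullet> v)))"
      by (cases "x \<bullet> v \<ge> 0") (auto simp: abs_if)
    then show "norm (exp (c * \<bar>x \<bullet> v\<bar>))
      \<le> norm (exp (x \<bullet> (c *\<^sub>R v)) + exp (x \<bullet> (- c *\<^sub>R v)))" by simp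
  qed
qed auto

lemma integrable_gaussian_abs_inner:
  fixes v :: "real ^ 'n"
  shows "integrable std_gaussian (\<lambda>x. \<bar>v \<bullet> x\<bar>)"
proof (rule Bochner_Integration.integrable_bound)
  show "integrable std_gaussian (\<lambda>x. exp (1 * \<bar>x \<bullet> v\<bar>))"
    by (rule integrable_gaussian_exp_abs_inner)
  have "\<bar>r\<bar> \<le> exp \<bar>r\<bar>" for r :: real
    using exp_ge_add_one_self[of "\<bar>r\<bar>"] by linarith
  then show "AE x in std_gaussian. norm \<bar>v \<bullet> x\<bar> \<le> norm (exp (1 * \<bar>x \<bullet> v\<bar>))"
    by (simp add: inner_commute)
qed auto

lemma integrable_gaussian_inner:
  fixes v :: "real ^ 'n"
  shows "integrable std_gaussian (\<lambda>x. v \<bullet> x)"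
  by (rule integrable_abs_cancel[OF integrable_gaussian_abs_inner]) simp

lemma integrable_gaussian_norm: "integrable std_gaussian (\<lambda>x :: real ^ 'n. norm x)"
proof (rule Bochner_Integration.integrable_bound)
  show "integrable std_gaussian (\<lambda>x :: real ^ 'n. \<Sum>b\<in>Basis. \<bar>b \<bullet> x\<bar>)"
    by (intro Bochner_Integration.integrable_sum integrable_gaussian_abs_inner)
  have "norm x \<le> (\<Sum>b\<in>Basis. \<bar>b \<bullet> x\<bar>)" for x :: "real ^ 'n"
    using norm_le_l1[of x] by (simp add: inner_commute)
  then show "AE x in std_gaussian. norm (norm (x :: real ^ 'n)) \<le> norm (\<Sum>b\<in>Basis. \<bar>b \<bullet> x\<bar>)"
    by (simp add: sum_nonneg)
qed auto

section \<open>Gaussian integration by parts\<close>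

text \<open>A bound on the derivative bounds the difference quotients by the mean value theorem, so
dominated convergence applies to them.\<close>

lemma DERIV_integral_dominated:
  fixes F F' :: "real \<Rightarrow> 'a \<Rightarrow> real"
  assumes F: "\<And>v. integrable M (F v)" and G: "integrable M G"
    and D: "\<And>v x. \<bar>v - t\<bar> \<le> 1 \<Longrightarrow> ((\<lambda>v. F v x) has_real_derivative F' v x) (at v)"
    and B: "\<And>v x. \<bar>v - t\<bar> \<le> 1 \<Longrightarrow> \<bar>F' v x\<bar> \<le> G x"
  shows "((\<lambda>v. \<integral>x. F v x \<partial>M) has_real_derivative (\<integral>x. F' t x \<partial>M)) (at t)"
  unfolding has_field_derivative_iff tendsto_at_iff_sequentially
proof (intro allI impI)
  fix w assume w: "\<forall>i. w i \<in> UNIV - {t}" and "w \<longlonglongrightarrow> t"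
  then obtain k where k: "\<And>i. i \<ge> k \<Longrightarrow> \<bar>w i - t\<bar> < 1"
    using LIMSEQ_D[of w t 1] by auto
  define q where "q i x = (F (w (i + k)) x - F t x) / (w (i + k) - t)" for i x
  have wk: "(\<lambda>i. w (i + k)) \<longlonglongrightarrow> t" using \<open>w \<longlonglongrightarrow> t\<close> by (rule LIMSEQ_ignore_initial_segment)
  have q_int: "integrable M (q i)" for i
    unfolding q_def by (intro Bochner_Integration.integrable_divide Bochner_Integration.integrable_diff F)
  have q_lim: "(\<lambda>i. q i x) \<longlonglongrightarrow> F' t x" for x
  proof -
    have "((\<lambda>v. (F v x - F t x) / (v - t)) \<longlongrightarrow> F' t x) (at t)"
      using D[of t x] by (simp add: has_field_derivative_iff)
    then show ?thesis
      unfolding tendsto_at_iff_sequentially using wk w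
      by (auto simp: q_def o_def)
  qed
  have q_bd: "\<bar>q i x\<bar> \<le> G x" for i x
  proof -
    have "norm (F (w (i + k)) x - F t x) \<le> G x * norm (w (i + k) - t)"
      by (rule field_differentiable_bound[where S = "cball t 1" and f' = "\<lambda>v. F' v x"])
        (use k[of "i + k"] in \<open>auto simp: dist_real_def abs_minus_commute
          intro: has_field_derivative_at_within D B\<close>)
    moreover have "w (i + k) - t \<noteq> 0" using w by auto
    ultimately show ?thesis by (simp add: q_def divide_simps)
  qed
  have [measurable]: "F' t \<in> borel_measurable M"
    by (rule borel_measurable_LIMSEQ_real[of _ q]) (use q_lim q_int in auto)
  have "(\<lambda>i. integral\<^sup>L M (q i)) \<longlonglongrightarrow> integral\<^sup>L M (F' t)"
    by (rule integral_dominated_convergence[where w = G]) (use q_int q_bd q_lim G in auto)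
  moreover have "integral\<^sup>L M (q i)
      = ((\<integral>x. F (w (i + k)) x \<partial>M) - (\<integral>x. F t x \<partial>M)) / (w (i + k) - t)" for i
    unfolding q_def by (simp add: F)
  ultimately have "(\<lambda>i. ((\<lambda>v. ((\<integral>x. F v x \<partial>M) - (\<integral>x. F t x \<partial>M)) / (v - t)) \<circ> w) (i + k))
      \<longlonglongrightarrow> (\<integral>x. F' t x \<partial>M)"
    by simp
  then show "((\<lambda>v. ((\<integral>x. F v x \<partial>M) - (\<integral>x. F t x \<partial>M)) / (v - t)) \<circ> w)
      \<longlonglongrightarrow> (\<integral>x. F' t x \<partial>M)"
    by (rule LIMSEQ_offset)
qed

text \<open>Both sides are the derivative at \<open>h = 0\<close> of the expectation of \<open>F (x + h v)\<close>: differentiating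
\<open>F\<close> gives the right-hand side, differentiating the density factor of
the Cameron--Martin formula gives the left-hand side.\<close>

lemma gaussian_integration_by_parts:
  fixes F F' :: "real ^ 'n \<Rightarrow> real" and v :: "real ^ 'n"
  assumes [measurable]: "F \<in> borel_measurable borel"
    and B: "\<And>x. \<bar>F x\<bar> \<le> B" and C: "\<And>x. \<bar>F' x\<bar> \<le> C"
    and D: "\<And>x h. ((\<lambda>h. F (x + h *\<^sub>R v)) has_real_derivative F' (x + h *\<^sub>R v)) (at h)"
  shows "(\<integral>x. F x * (v \<bullet> x) \<partial>std_gaussian) = (\<integral>x. F' x \<partial>std_gaussian)"
proof -
  interpret prob_space "std_gaussian :: (real ^ 'n) measure" by (rule prob_space_std_gaussian)
  define b where "b = (norm v)\<^sup>2"
  have b: "0 \<le> b" by (simp add: b_def)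
  have B0: "0 \<le> B" using B[of 0] by linarith
  define w where "w h x = exp (h * (x \<bullet> v) - h\<^sup>2 * b / 2)" for h and x :: "real ^ 'n"
  have wm[measurable]: "w h \<in> borel_measurable borel" for h unfolding w_def by measurable
  have w_int: "integrable std_gaussian (\<lambda>x. F x * w h x)" for h
  proof -
    have "integrable std_gaussian (\<lambda>x. F (x + h *\<^sub>R v))"
      by (rule integrable_const_bound[where B = B]) (use B in auto)
    then show ?thesis
      by (subst (asm) integrable_gaussian_shift) (auto simp: w_def b_def power_mult_distrib)
  qed
  have eq: "(\<integral>x. F (x + h *\<^sub>R v) \<partial>std_gaussian) = (\<integral>x. F x * w h x \<partial>std_gaussian)" for h
    by (subst integral_gaussian_shift) (auto simp: w_def b_def power_mult_distrib)
  have "((\<lambda>h. \<integral>x. F (x + h *\<^sub>R v) \<partial>std_gaussian) has_real_derivative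
      (\<integral>x. F' (x + 0 *\<^sub>R v) \<partial>std_gaussian)) (at 0)"
  proof (rule DERIV_integral_dominated[where G = "\<lambda>_. C"])
    show "integrable std_gaussian (\<lambda>x. F (x + h *\<^sub>R v))" for h
      by (rule integrable_const_bound[where B = B]) (use B in auto)
  qed (use C D in auto)
  moreover have "((\<lambda>h. \<integral>x. F x * w h x \<partial>std_gaussian) has_real_derivative
      (\<integral>x. F x * ((x \<bullet> v - 0 * b) * w 0 x) \<partial>std_gaussian)) (at 0)"
  \<comment> \<open>The polynomial factor \<open>|x \<bullet> v| + b\<close> of the derivative is dominated by \<open>(1 + b) exp |x \<bullet> v|\<close>.\<close>
  proof (rule DERIV_integral_dominated[where G = "\<lambda>x. B * ((1 + b) * exp (2 * \<bar>x \<bullet> v\<bar>))"])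
    show "integrable std_gaussian (\<lambda>x. F x * w h x)" for h by (rule w_int)
    show "integrable std_gaussian (\<lambda>x. B * ((1 + b) * exp (2 * \<bar>x \<bullet> v\<bar>)))"
      by (intro integrable_mult_right integrable_gaussian_exp_abs_inner)
    show "((\<lambda>h. F x * w h x) has_real_derivative F x * ((x \<bullet> v - h * b) * w h x)) (at h)" for h x
      unfolding w_def by (auto intro!: derivative_eq_intros)
    show "\<bar>F x * ((x \<bullet> v - h * b) * w h x)\<bar> \<le> B * ((1 + b) * exp (2 * \<bar>x \<bullet> v\<bar>))"
      if "\<bar>h - 0\<bar> \<le> 1" for h x
    proof -
      have h: "\<bar>h\<bar> \<le> 1" using that by simp
      have "h * (x \<bullet> v) \<le> \<bar>h\<bar> * \<bar>x \<bullet> v\<bar>"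
        by (simp add: abs_mult[symmetric])
      also have "\<dots> \<le> \<bar>x \<bullet> v\<bar>"
        using mult_right_mono[OF h, of "\<bar>x \<bullet> v\<bar>"] by simp
      finally have "h * (x \<bullet> v) \<le> \<bar>x \<bullet> v\<bar>" .
      moreover have "0 \<le> h\<^sup>2 * b / 2" using b by simp
      ultimately have w: "w h x \<le> exp \<bar>x \<bullet> v\<bar>" by (simp add: w_def)
      have "\<bar>x \<bullet> v - h * b\<bar> \<le> \<bar>x \<bullet> v\<bar> + b"
        using mult_right_mono[OF h b] b abs_triangle_ineq4[of "x \<bullet> v" "h * b"] by (simp add: abs_mult)
      also have "\<dots> \<le> exp \<bar>x \<bullet> v\<bar> + b * exp \<bar>x \<bullet> v\<bar>"
        using exp_ge_add_one_self[of "\<bar>x \<bullet> v\<bar>"] mult_left_mono[OF _ b, of 1 "exp \<bar>x \<bullet> v\<bar>"]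
        by (smt (verit, best) abs_ge_zero mult_cancel_left1 one_le_exp_iff mult.right_neutral)
      also have "\<dots> = (1 + b) * exp \<bar>x \<bullet> v\<bar>" by (simp add: algebra_simps)
      finally have "\<bar>x \<bullet> v - h * b\<bar> * w h x \<le> ((1 + b) * exp \<bar>x \<bullet> v\<bar>) * exp \<bar>x \<bullet> v\<bar>"
        using w b by (intro mult_mono) (auto simp: w_def)
      also have "\<dots> = (1 + b) * exp (2 * \<bar>x \<bullet> v\<bar>)" by (simp add: mult.assoc exp_add[symmetric])
      finally have "\<bar>F x\<bar> * (\<bar>x \<bullet> v - h * b\<bar> * w h x) \<le> B * ((1 + b) * exp (2 * \<bar>x \<bullet> v\<bar>))"
        by (rule mult_mono[OF B]) (auto simp: B0 w_def)
      then show ?thesis by (simp add: abs_mult w_def)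
    qed
  qed
  ultimately have "(\<integral>x. F' (x + 0 *\<^sub>R v) \<partial>std_gaussian)
      = (\<integral>x. F x * ((x \<bullet> v - 0 * b) * w 0 x) \<partial>std_gaussian)"
    unfolding eq by (rule DERIV_unique)
  then show ?thesis by (simp add: w_def inner_commute)
qed

section \<open>Entropy and collision probability\<close>

text \<open>A quantitative form of the fact that a distribution concentrated on one point \<open>k\<close> has small
entropy: by Gibbs' inequality the entropy is at most the cross entropy with any other
distribution \<open>q\<close>, here the equal mixture of the point mass at \<open>k\<close> and the uniform one.\<close>

lemma entropy_le_one_atom:
  fixes p :: "'a \<Rightarrow> real"
  assumes "finite A" "k \<in> A" and p: "\<And>i. i \<in> A \<Longrightarrow> 0 < p i" and "sum p A = 1"
  shows "- (\<Sum>i\<in>A. p i * ln (p i)) \<le> ln 2 + (1 - p k) * ln (card A)"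
proof -
  define N where "N = real (card A)"
  have "A \<noteq> {}" using \<open>k \<in> A\<close> by blast
  then have N: "0 < N" using \<open>finite A\<close> by (simp add: N_def card_gt_0_iff)
  define q where "q i = (if i = k then 1 / 2 else 0) + 1 / (2 * N)" for i
  have q: "0 < q i" for i using N by (simp add: q_def add_pos_pos)
  have "sum q A = 1"
    using assms N \<open>A \<noteq> {}\<close> by (simp add: q_def sum.distrib N_def)
  have gibbs: "p i * (ln (q i) - ln (p i)) \<le> q i - p i" if "i \<in> A" for i
  proof -
    have "ln (q i) - ln (p i) \<le> q i / p i - 1"
      using ln_le_minus_one[of "q i / p i"] p[OF that] q[of i] by (simp add: ln_div)
    from mult_left_mono[OF this, of "p i"] p[OF that] show ?thesis
      by (simp add: right_diff_distrib)
  qed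
  have lnq: "- ln (q i) \<le> ln 2 + (if i = k then 0 else ln N)" for i
  proof (cases "i = k")
    case True
    then have "ln (1 / 2) \<le> ln (q i)" using N by (subst ln_le_cancel_iff) (auto simp: q_def add_pos_pos)
    then show ?thesis using True by (simp add: ln_div)
  next
    case False
    then show ?thesis using N by (simp add: q_def ln_div ln_mult)
  qed
  have "(\<Sum>i\<in>A. p i * (ln (q i) - ln (p i))) \<le> (\<Sum>i\<in>A. q i - p i)"
    by (intro sum_mono gibbs)
  also have "\<dots> = 0" using \<open>sum q A = 1\<close> \<open>sum p A = 1\<close> by (simp add: sum_subtractf)
  finally have "- (\<Sum>i\<in>A. p i * ln (p i)) \<le> (\<Sum>i\<in>A. p i * - ln (q i))"
    by (simp add: sum_subtractf right_diff_distrib sum_negf)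
  also have "\<dots> \<le> (\<Sum>i\<in>A. p i * (ln 2 + (if i = k then 0 else ln N)))"
    by (intro sum_mono mult_left_mono lnq) (use p less_imp_le in auto)
  also have "\<dots> = (\<Sum>i\<in>A. p i * (ln 2 + ln N) - (if i = k then p i * ln N else 0))"
    by (intro sum.cong) (auto simp: algebra_simps)
  also have "\<dots> = (\<Sum>i\<in>A. p i) * (ln 2 + ln N) - p k * ln N"
    using \<open>finite A\<close> \<open>k \<in> A\<close> by (simp add: sum_subtractf sum_distrib_right)
  also have "\<dots> = ln 2 + (1 - p k) * ln N"
    by (simp add: \<open>sum p A = 1\<close> algebra_simps)
  finally show ?thesis by (simp add: N_def)
qed

text \<open>The previous bound holds for every atom \<open>k\<close>; averaging it over \<open>k\<close> with weights \<open>p k\<close> replaces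
\<open>p k\<close> by the collision probability.\<close>

lemma entropy_le_collision:
  fixes p :: "'a \<Rightarrow> real"
  assumes "finite A" and p: "\<And>i. i \<in> A \<Longrightarrow> 0 < p i" and "sum p A = 1"
  shows "- (\<Sum>i\<in>A. p i * ln (p i)) \<le> ln 2 + (1 - (\<Sum>i\<in>A. (p i)\<^sup>2)) * ln (card A)"
proof -
  let ?H = "- (\<Sum>i\<in>A. p i * ln (p i))"
  have "?H = (\<Sum>k\<in>A. p k * ?H)"
    unfolding sum_distrib_right[symmetric] by (simp add: assms)
  also have "\<dots> \<le> (\<Sum>k\<in>A. p k * (ln 2 + (1 - p k) * ln (card A)))"
    by (intro sum_mono mult_left_mono entropy_le_one_atom) (use assms less_imp_le in auto)
  also have "\<dots> = (\<Sum>k\<in>A. p k * (ln 2 + ln (card A)) - (p k)\<^sup>2 * ln (card A))"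
    by (intro sum.cong) (auto simp: algebra_simps power2_eq_square)
  also have "\<dots> = ln 2 + (1 - (\<Sum>i\<in>A. (p i)\<^sup>2)) * ln (card A)"
    by (simp only: sum_subtractf sum_distrib_right[symmetric] assms) (simp add: algebra_simps)
  finally show ?thesis .
qed

section \<open>A differential inequality\<close>

text \<open>The equation \<open>a t (f - t f') = f'\<close> is solved by multiples of \<open>sqrt (1 + a t\<^sup>2)\<close>, and the
inequality says that the quotient of \<open>f\<close> by this solution is nondecreasing.\<close>

lemma growth_of_differential_inequality:
  fixes f f' :: "real \<Rightarrow> real"
  assumes D: "\<And>t. 0 \<le> t \<Longrightarrow> (f has_real_derivative f' t) (at t)"
    and ineq: "\<And>t. 0 \<le> t \<Longrightarrow> a * t * (f t - t * f' t) \<le> f' t"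
    and "0 \<le> a" "0 \<le> r"
  shows "f 0 * sqrt (1 + a * r\<^sup>2) \<le> f r"
proof -
  define S where "S t = sqrt (1 + a * t\<^sup>2)" for t
  have pos: "0 < 1 + a * t\<^sup>2" for t
    using \<open>0 \<le> a\<close> by (simp add: add_pos_nonneg)
  have S: "0 < S t" for t unfolding S_def using pos by simp
  have S2: "S t * S t = 1 + a * t\<^sup>2" for t
    unfolding S_def using pos[of t] by simp
  have DS: "(S has_real_derivative a * t / S t) (at t)" for t
    unfolding S_def using pos[of t] by (auto intro!: derivative_eq_intros simp: field_simps)
  have "f 0 / S 0 \<le> f r / S r"
  proof (rule DERIV_nonneg_imp_nondecreasing[OF \<open>0 \<le> r\<close>])
    fix t :: real assume t: "0 \<le> t"
    let ?d = "(f' t * S t - f t * (a * t / S t)) / (S t * S t)"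
    have "((\<lambda>t. f t / S t) has_real_derivative ?d) (at t)"
      using S[of t] by (intro DERIV_divide D t DS) auto
    moreover have "0 \<le> f' t * (S t * S t) - f t * (a * t)"
      using ineq[OF t] unfolding S2 by (simp add: algebra_simps power2_eq_square)
    then have "0 \<le> ?d"
      using S[of t] by (simp add: field_simps)
    ultimately show "\<exists>y. ((\<lambda>t. f t / S t) has_real_derivative y) (at t) \<and> 0 \<le> y" by blast
  qed
  moreover have "S 0 = 1" by (simp add: S_def)
  ultimately show ?thesis using S[of r] by (simp add: S_def[symmetric] field_simps)
qed

section \<open>Gibbs weights\<close>

definition partition_fn :: "'a::real_inner set \<Rightarrow> real \<Rightarrow> 'a \<Rightarrow> real" where
  "partition_fn A t g = (\<Sum>w\<in>A. exp (t * (w \<bullet> g)))"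

definition gibbs :: "'a::real_inner set \<Rightarrow> real \<Rightarrow> 'a \<Rightarrow> 'a \<Rightarrow> real" where
  "gibbs A t g u = exp (t * (u \<bullet> g)) / partition_fn A t g"

context
  fixes A :: "'a::real_inner set"
  assumes fin: "finite A" and ne: "A \<noteq> {}"
begin

lemma partition_fn_pos: "0 < partition_fn A t g"
  unfolding partition_fn_def using fin ne by (intro sum_pos) auto

lemma gibbs_pos: "0 < gibbs A t g u"
  by (simp add: gibbs_def partition_fn_pos)

lemma sum_gibbs: "(\<Sum>u\<in>A. gibbs A t g u) = 1"
  using partition_fn_pos[of t g]
  by (simp add: gibbs_def sum_divide_distrib[symmetric] partition_fn_def[symmetric])

lemma gibbs_le_1: "u \<in> A \<Longrightarrow> gibbs A t g u \<le> 1"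
  using member_le_sum[of u A "gibbs A t g"] fin gibbs_pos sum_gibbs by (simp add: less_imp_le)

lemma abs_gibbs_mean_le: "\<bar>\<Sum>u\<in>A. gibbs A t g u * c u\<bar> \<le> (\<Sum>u\<in>A. \<bar>c u\<bar>)"
proof -
  have "\<bar>\<Sum>u\<in>A. gibbs A t g u * c u\<bar> \<le> (\<Sum>u\<in>A. \<bar>gibbs A t g u * c u\<bar>)" by (rule sum_abs)
  also have "\<dots> \<le> (\<Sum>u\<in>A. 1 * \<bar>c u\<bar>)"
    unfolding abs_mult
    by (intro sum_mono mult_right_mono) (use gibbs_pos[of t g] gibbs_le_1[of _ t g] in \<open>auto simp: abs_of_pos\<close>)
  finally show ?thesis by simp
qed

lemma DERIV_ln_partition_fn:
  "((\<lambda>t. ln (partition_fn A t g)) has_real_derivative (\<Sum>u\<in>A. gibbs A t g u * (u \<bullet> g))) (at t)"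
proof -
  have "((\<lambda>t. partition_fn A t g) has_real_derivative (\<Sum>u\<in>A. exp (t * (u \<bullet> g)) * (u \<bullet> g))) (at t)"
    unfolding partition_fn_def by (intro DERIV_sum) (auto intro!: derivative_eq_intros)
  from DERIV_chain2[OF DERIV_ln_divide[OF partition_fn_pos[of t g]] this]
  show ?thesis by (simp add: gibbs_def sum_divide_distrib)
qed

lemma DERIV_gibbs_direction:
  "((\<lambda>h. gibbs A t (g + h *\<^sub>R v) u) has_real_derivative
    t * (gibbs A t (g + h *\<^sub>R v) u * (u \<bullet> v - (\<Sum>w\<in>A. gibbs A t (g + h *\<^sub>R v) w * (w \<bullet> v))))) (at h)"
proof -
  let ?g = "g + h *\<^sub>R v"
  have e: "((\<lambda>h. exp (t * (w \<bullet> (g + h *\<^sub>R v)))) has_real_derivative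
      t * (exp (t * (w \<bullet> ?g)) * (w \<bullet> v))) (at h)" for w
    by (auto intro!: derivative_eq_intros simp: inner_add_right)
  have Z: "((\<lambda>h. partition_fn A t (g + h *\<^sub>R v)) has_real_derivative
      (\<Sum>w\<in>A. t * (exp (t * (w \<bullet> ?g)) * (w \<bullet> v)))) (at h)"
    unfolding partition_fn_def by (intro DERIV_sum e)
  have "((\<lambda>h. gibbs A t (g + h *\<^sub>R v) u) has_real_derivative
     (t * (exp (t * (u \<bullet> ?g)) * (u \<bullet> v)) * partition_fn A t ?g
       - exp (t * (u \<bullet> ?g)) * (\<Sum>w\<in>A. t * (exp (t * (w \<bullet> ?g)) * (w \<bullet> v))))
      / (partition_fn A t ?g * partition_fn A t ?g)) (at h)"
    unfolding gibbs_def using partition_fn_pos[of t ?g] by (intro DERIV_divide e Z) auto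
  moreover have "(\<Sum>w\<in>A. t * (exp (t * (w \<bullet> ?g)) * (w \<bullet> v)))
      = t * ((\<Sum>w\<in>A. gibbs A t ?g w * (w \<bullet> v)) * partition_fn A t ?g)"
    using partition_fn_pos[of t ?g]
    by (simp add: gibbs_def sum_distrib_left sum_distrib_right)
  moreover have "(t * (e * a) * z - e * (t * (s * z))) / (z * z) = t * (e / z * (a - s))"
    if "0 < z" for e a s z :: real
    using that by (simp add: field_simps)
  ultimately show ?thesis
    using partition_fn_pos[of t ?g] by (simp add: gibbs_def[of A t "g + h *\<^sub>R v" u])
qed

lemma ln_partition_fn_le:
  assumes "0 \<le> t" and "\<And>u. u \<in> A \<Longrightarrow> u \<bullet> g \<le> b"
  shows "ln (partition_fn A t g) \<le> ln (card A) + t * b"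
proof -
  have "partition_fn A t g \<le> (\<Sum>w\<in>A. exp (t * b))"
    unfolding partition_fn_def using assms by (intro sum_mono) (auto intro!: mult_left_mono)
  then have "ln (partition_fn A t g) \<le> ln (card A * exp (t * b))"
    using partition_fn_pos[of t g] by (subst ln_le_cancel_iff) (auto simp: card_gt_0_iff fin ne)
  then show ?thesis using fin ne by (simp add: ln_mult card_gt_0_iff)
qed

lemma abs_ln_partition_fn_le:
  "\<bar>ln (partition_fn A t g)\<bar> \<le> ln (card A) + \<bar>t\<bar> * (\<Sum>u\<in>A. \<bar>u \<bullet> g\<bar>)"
proof -
  let ?b = "\<Sum>u\<in>A. \<bar>u \<bullet> g\<bar>"
  have c: "1 \<le> card A" using fin ne by (simp add: Suc_le_eq card_gt_0_iff)
  have b: "\<bar>u \<bullet> g\<bar> \<le> ?b" if "u \<in> A" for u using member_le_sum[of u A "\<lambda>u. \<bar>u \<bullet> g\<bar>"] that fin by auto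
  have tb: "\<bar>t * (u \<bullet> g)\<bar> \<le> \<bar>t\<bar> * ?b" if "u \<in> A" for u
    unfolding abs_mult by (intro mult_left_mono b that) auto
  obtain u where u: "u \<in> A" using ne by auto
  have "exp (t * (u \<bullet> g)) \<le> partition_fn A t g"
    unfolding partition_fn_def by (rule member_le_sum[OF u, of "\<lambda>w. exp (t * (w \<bullet> g))"]) (auto simp: fin)
  then have "t * (u \<bullet> g) \<le> ln (partition_fn A t g)"
    by (simp add: ln_ge_iff partition_fn_pos)
  moreover have "0 \<le> ln (card A)" using c by simp
  moreover have "partition_fn A t g \<le> (\<Sum>w\<in>A. exp (\<bar>t\<bar> * ?b))"
    unfolding partition_fn_def using tb by (intro sum_mono) (auto simp: abs_le_iff)
  then have "ln (partition_fn A t g) \<le> ln (card A * exp (\<bar>t\<bar> * ?b))"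
    using partition_fn_pos[of t g] c by (subst ln_le_cancel_iff) auto
  then have "ln (partition_fn A t g) \<le> ln (card A) + \<bar>t\<bar> * ?b"
    using c by (simp add: ln_mult)
  ultimately show ?thesis using tb[OF u] by linarith
qed

text \<open>The left-hand side is the entropy of the Gibbs weights.\<close>

lemma free_energy_le_collision:
  "ln (partition_fn A t g) - t * (\<Sum>u\<in>A. gibbs A t g u * (u \<bullet> g))
    \<le> ln 2 + (1 - (\<Sum>u\<in>A. (gibbs A t g u)\<^sup>2)) * ln (card A)"
proof -
  have "ln (gibbs A t g u) = t * (u \<bullet> g) - ln (partition_fn A t g)" for u
    using partition_fn_pos[of t g] by (simp add: gibbs_def ln_div)
  then have "- (\<Sum>u\<in>A. gibbs A t g u * ln (gibbs A t g u))
      = (\<Sum>u\<in>A. gibbs A t g u) * ln (partition_fn A t g) - t * (\<Sum>u\<in>A. gibbs A t g u * (u \<bullet> g))"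
    by (simp add: right_diff_distrib sum_subtractf sum_distrib_left sum_distrib_right mult.left_commute)
  then show ?thesis
    using entropy_le_collision[of A "gibbs A t g"] fin gibbs_pos sum_gibbs by simp
qed

text \<open>The right-hand side is the variance of a random point with the Gibbs weights as its law, that
is, half the mean squared distance of two independent copies. The copies are at least \<open>\<epsilon>\<close>
apart unless they coincide, which has probability \<open>\<Sum> p\<^sup>2\<close>.\<close>

lemma gibbs_variance_ge_collision:
  assumes "0 \<le> \<epsilon>" and sep: "\<And>u w. u \<in> A \<Longrightarrow> w \<in> A \<Longrightarrow> u \<noteq> w \<Longrightarrow> \<epsilon> \<le> norm (u - w)"
  shows "\<epsilon>\<^sup>2 / 2 * (1 - (\<Sum>u\<in>A. (gibbs A t g u)\<^sup>2))
    \<le> (\<Sum>u\<in>A. gibbs A t g u * (u \<bullet> u - (\<Sum>w\<in>A. gibbs A t g w * (w \<bullet> u))))"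
proof -
  let ?p = "gibbs A t g"
  \<comment> \<open>Each of the two copies has the Gibbs weights as its marginal distribution.\<close>
  have s1: "(\<Sum>u\<in>A. \<Sum>w\<in>A. ?p u * ?p w * c u) = (\<Sum>u\<in>A. ?p u * c u)" for c
    by (simp add: sum_distrib_left[symmetric] sum_distrib_right[symmetric] sum_gibbs)
  have s2: "(\<Sum>u\<in>A. \<Sum>w\<in>A. ?p u * ?p w * c w) = (\<Sum>u\<in>A. ?p u * c u)" for c
    by (simp add: mult.assoc sum_distrib_left[symmetric] sum_distrib_right[symmetric] sum_gibbs)
  have "\<epsilon>\<^sup>2 * (1 - (\<Sum>u\<in>A. (?p u)\<^sup>2)) = (\<Sum>u\<in>A. \<Sum>w\<in>A. if u = w then 0 else ?p u * ?p w * \<epsilon>\<^sup>2)"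
  proof -
    have "(\<Sum>w\<in>A. if u = w then 0 else ?p u * ?p w * \<epsilon>\<^sup>2) = ?p u * \<epsilon>\<^sup>2 - (?p u)\<^sup>2 * \<epsilon>\<^sup>2" if "u \<in> A" for u
    proof -
      have "(\<Sum>w\<in>A. if u = w then 0 else ?p u * ?p w * \<epsilon>\<^sup>2)
          = (\<Sum>w\<in>A. ?p u * ?p w * \<epsilon>\<^sup>2 - (if u = w then ?p u * ?p w * \<epsilon>\<^sup>2 else 0))"
        by (intro sum.cong) auto
      also have "\<dots> = ?p u * (\<Sum>w\<in>A. ?p w) * \<epsilon>\<^sup>2 - (?p u)\<^sup>2 * \<epsilon>\<^sup>2"
        using that fin by (simp add: sum_subtractf sum_distrib_left sum_distrib_right power2_eq_square)
      finally show ?thesis by (simp add: sum_gibbs)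
    qed
    then have "(\<Sum>u\<in>A. \<Sum>w\<in>A. if u = w then 0 else ?p u * ?p w * \<epsilon>\<^sup>2)
        = (\<Sum>u\<in>A. ?p u * \<epsilon>\<^sup>2 - (?p u)\<^sup>2 * \<epsilon>\<^sup>2)"
      by (intro sum.cong refl)
    also have "\<dots> = \<epsilon>\<^sup>2 * (1 - (\<Sum>u\<in>A. (?p u)\<^sup>2))"
      by (simp only: sum_subtractf sum_distrib_right[symmetric] sum_gibbs) (simp add: algebra_simps)
    finally show ?thesis by simp
  qed
  also have "\<dots> \<le> (\<Sum>u\<in>A. \<Sum>w\<in>A. ?p u * ?p w * (norm (u - w))\<^sup>2)"
  proof (intro sum_mono)
    fix u w assume "u \<in> A" "w \<in> A"
    then show "(if u = w then 0 else ?p u * ?p w * \<epsilon>\<^sup>2) \<le> ?p u * ?p w * (norm (u - w))\<^sup>2"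
      using sep[of u w] \<open>0 \<le> \<epsilon>\<close> gibbs_pos[of t g]
      by (auto intro!: mult_left_mono power_mono simp: less_imp_le)
  qed
  also have "\<dots> = (\<Sum>u\<in>A. \<Sum>w\<in>A. ?p u * ?p w * (u \<bullet> u) + ?p u * ?p w * (w \<bullet> w) - 2 * (?p u * (?p w * (w \<bullet> u))))"
    by (intro sum.cong refl)
      (simp add: power2_norm_eq_inner inner_diff_left inner_diff_right inner_commute algebra_simps)
  also have "\<dots> = 2 * (\<Sum>u\<in>A. ?p u * (u \<bullet> u - (\<Sum>w\<in>A. ?p w * (w \<bullet> u))))"
    by (simp add: sum.distrib sum_subtractf s1[of "\<lambda>u. u \<bullet> u"] s2[of "\<lambda>u. u \<bullet> u"] right_diff_distrib
      sum_distrib_left)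
  finally show ?thesis by simp
qed

end

section \<open>Sudakov's inequality\<close>

lemma bdd_above_support:
  fixes S :: "'a::real_inner set"
  assumes "\<And>u. u \<in> S \<Longrightarrow> norm u \<le> r"
  shows "bdd_above ((\<lambda>u. u \<bullet> g) ` S)"
proof (rule bdd_aboveI2)
  fix u assume "u \<in> S"
  have "u \<bullet> g \<le> norm u * norm g" by (rule norm_cauchy_schwarz)
  also have "\<dots> \<le> r * norm g" by (rule mult_right_mono) (auto intro: assms \<open>u \<in> S\<close>)
  finally show "u \<bullet> g \<le> r * norm g" .
qed

text \<open>The support function of a set in the ball of radius \<open>r\<close> is \<open>r\<close>-Lipschitz, which makes it
measurable even when the supremum is over uncountably many points.\<close>

lemma integrable_gaussian_support:
  fixes S :: "(real ^ 'n) set"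
  assumes S: "\<And>u. u \<in> S \<Longrightarrow> norm u \<le> r" and "S \<noteq> {}"
  shows "integrable std_gaussian (\<lambda>g. SUP u\<in>S. u \<bullet> g)"
proof (rule Bochner_Integration.integrable_bound)
  let ?h = "\<lambda>g. SUP u\<in>S. u \<bullet> g"
  obtain u0 where u0: "u0 \<in> S" using \<open>S \<noteq> {}\<close> by auto
  have "0 \<le> r" using S[OF u0] norm_ge_zero order_trans by blast
  have cs: "\<bar>u \<bullet> g\<bar> \<le> r * norm g" if "u \<in> S" for u g
    using Cauchy_Schwarz_ineq2[of u g] mult_right_mono[OF S[OF that], of "norm g"] by simp
  have upper: "u \<bullet> g \<le> ?h g" if "u \<in> S" for u g
    by (rule cSUP_upper[OF that bdd_above_support[OF S]])
  have lip: "?h g \<le> ?h g' + r * norm (g - g')" for g g'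
  proof (rule cSUP_least[OF \<open>S \<noteq> {}\<close>])
    fix u assume u: "u \<in> S"
    have "u \<bullet> g = u \<bullet> g' + u \<bullet> (g - g')" by (simp add: inner_diff_right)
    then show "u \<bullet> g \<le> ?h g' + r * norm (g - g')"
      using upper[OF u, of g'] cs[OF u, of "g - g'"] by linarith
  qed
  have "r-lipschitz_on UNIV ?h"
  proof (rule lipschitz_onI)
    show "dist (?h g) (?h g') \<le> r * dist g g'" for g g'
      using lip[of g g'] lip[of g' g] by (simp add: dist_real_def dist_norm norm_minus_commute)
  qed fact
  then have "?h \<in> borel_measurable borel"
    by (intro borel_measurable_continuous_onI lipschitz_on_continuous_on)
  then show "?h \<in> borel_measurable std_gaussian" by simp
  show "integrable std_gaussian (\<lambda>g :: real ^ 'n. r * norm g)"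
    by (intro integrable_mult_right integrable_gaussian_norm)
  have "\<bar>?h g\<bar> \<le> r * norm g" for g
  proof -
    have "?h g \<le> r * norm g"
      by (rule cSUP_least[OF \<open>S \<noteq> {}\<close>]) (use cs in \<open>auto simp: abs_le_iff\<close>)
    then show ?thesis using upper[OF u0, of g] cs[OF u0, of g] by linarith
  qed
  then show "AE g in std_gaussian. norm (?h g) \<le> norm (r * norm g)"
    using \<open>0 \<le> r\<close> by simp
qed

lemma partition_fn_measurable [measurable]: "partition_fn A t \<in> borel_measurable borel"
  for A :: "(real ^ 'n) set"
  unfolding partition_fn_def by measurable

lemma gibbs_measurable [measurable]: "(\<lambda>g. gibbs A t g u) \<in> borel_measurable borel"
  for A :: "(real ^ 'n) set"
  unfolding gibbs_def by measurable

context
  fixes A :: "(real ^ 'n) set"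
  assumes fin: "finite A" and ne: "A \<noteq> {}"
begin

interpretation prob_space "std_gaussian :: (real ^ 'n) measure"
  by (rule prob_space_std_gaussian)

lemma integrable_gibbs_times:
  assumes "u \<in> A" and f: "integrable std_gaussian f"
  shows "integrable std_gaussian (\<lambda>g. gibbs A t g u * f g)"
proof (rule Bochner_Integration.integrable_bound[OF f])
  have [measurable]: "f \<in> borel_measurable borel"
    using borel_measurable_integrable[OF f] by simp
  show "(\<lambda>g. gibbs A t g u * f g) \<in> borel_measurable std_gaussian" by measurable
  show "AE g in std_gaussian. norm (gibbs A t g u * f g) \<le> norm (f g)"
    using gibbs_le_1[OF fin ne \<open>u \<in> A\<close>, of t] gibbs_pos[OF fin ne, of t]
    by (intro AE_I2) (simp add: abs_mult abs_of_pos mult_left_le_one_le less_imp_le)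
qed

lemma integrable_gibbs_mean:
  assumes "\<And>u. u \<in> A \<Longrightarrow> integrable std_gaussian (c u)"
  shows "integrable std_gaussian (\<lambda>g. \<Sum>u\<in>A. gibbs A t g u * c u g)"
  by (intro Bochner_Integration.integrable_sum integrable_gibbs_times assms)

lemma integrable_ln_partition_fn: "integrable std_gaussian (\<lambda>g. ln (partition_fn A t g))"
proof (rule Bochner_Integration.integrable_bound)
  show "integrable std_gaussian (\<lambda>g. ln (card A) + \<bar>t\<bar> * (\<Sum>u\<in>A. \<bar>u \<bullet> g\<bar>))"
    by (intro Bochner_Integration.integrable_add integrable_const integrable_mult_right
        Bochner_Integration.integrable_sum integrable_gaussian_abs_inner)
  show "AE g in std_gaussian. norm (ln (partition_fn A t g))
      \<le> norm (ln (card A) + \<bar>t\<bar> * (\<Sum>u\<in>A. \<bar>u \<bullet> g\<bar>))"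
    using abs_ln_partition_fn_le[OF fin ne, of t] by (auto intro: order_trans[OF _ abs_ge_self])
qed auto

lemma DERIV_gaussian_free_energy:
  "((\<lambda>t. \<integral>g. ln (partition_fn A t g) \<partial>std_gaussian) has_real_derivative
    (\<integral>g. (\<Sum>u\<in>A. gibbs A t g u * (u \<bullet> g)) \<partial>std_gaussian)) (at t)"
  by (rule DERIV_integral_dominated[where G = "\<lambda>g. \<Sum>u\<in>A. \<bar>u \<bullet> g\<bar>"])
    (auto intro: integrable_ln_partition_fn DERIV_ln_partition_fn[OF fin ne] abs_gibbs_mean_le[OF fin ne]
       Bochner_Integration.integrable_sum integrable_gaussian_abs_inner)

text \<open>Integration by parts in direction \<open>u\<close>, applied to the weight of each \<open>u\<close> separately.\<close>

lemma gaussian_gibbs_mean_eq: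
  "(\<integral>g. (\<Sum>u\<in>A. gibbs A t g u * (u \<bullet> g)) \<partial>std_gaussian)
   = t * (\<integral>g. (\<Sum>u\<in>A. gibbs A t g u * (u \<bullet> u - (\<Sum>w\<in>A. gibbs A t g w * (w \<bullet> u)))) \<partial>std_gaussian)"
proof -
  let ?F' = "\<lambda>u g. t * (gibbs A t g u * (u \<bullet> u - (\<Sum>w\<in>A. gibbs A t g w * (w \<bullet> u))))"
  have bound: "\<bar>?F' u g\<bar> \<le> \<bar>t\<bar> * (\<bar>u \<bullet> u\<bar> + (\<Sum>w\<in>A. \<bar>w \<bullet> u\<bar>))" if "u \<in> A" for u g
  proof -
    have "\<bar>u \<bullet> u - (\<Sum>w\<in>A. gibbs A t g w * (w \<bullet> u))\<bar> \<le> \<bar>u \<bullet> u\<bar> + (\<Sum>w\<in>A. \<bar>w \<bullet> u\<bar>)"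
      using abs_gibbs_mean_le[OF fin ne, of t g "\<lambda>w. w \<bullet> u"] by linarith
    then have "gibbs A t g u * \<bar>u \<bullet> u - (\<Sum>w\<in>A. gibbs A t g w * (w \<bullet> u))\<bar>
        \<le> 1 * (\<bar>u \<bullet> u\<bar> + (\<Sum>w\<in>A. \<bar>w \<bullet> u\<bar>))"
      using gibbs_le_1[OF fin ne that, of t g] by (intro mult_mono) auto
    then show ?thesis
      using gibbs_pos[OF fin ne, of t g u] by (simp add: abs_mult mult_left_mono)
  qed
  have int: "integrable std_gaussian (?F' u)" if "u \<in> A" for u
    by (rule integrable_const_bound[where B = "\<bar>t\<bar> * (\<bar>u \<bullet> u\<bar> + (\<Sum>w\<in>A. \<bar>w \<bullet> u\<bar>))"])
      (use bound[OF that] in auto)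
  have part: "(\<integral>g. gibbs A t g u * (u \<bullet> g) \<partial>std_gaussian) = (\<integral>g. ?F' u g \<partial>std_gaussian)" if "u \<in> A" for u
    by (rule gaussian_integration_by_parts[where B = 1, OF _ _ bound[OF that] DERIV_gibbs_direction[OF fin ne]])
      (use gibbs_le_1[OF fin ne that, of t] gibbs_pos[OF fin ne, of t] in \<open>auto simp: abs_of_pos\<close>)
  have "(\<integral>g. (\<Sum>u\<in>A. gibbs A t g u * (u \<bullet> g)) \<partial>std_gaussian)
      = (\<Sum>u\<in>A. \<integral>g. gibbs A t g u * (u \<bullet> g) \<partial>std_gaussian)"
    by (intro Bochner_Integration.integral_sum integrable_gibbs_times integrable_gaussian_inner)
  also have "\<dots> = (\<Sum>u\<in>A. \<integral>g. ?F' u g \<partial>std_gaussian)"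
    by (intro sum.cong part refl)
  also have "\<dots> = (\<integral>g. (\<Sum>u\<in>A. ?F' u g) \<partial>std_gaussian)"
    by (rule Bochner_Integration.integral_sum[symmetric]) (rule int)
  finally show ?thesis by (simp add: sum_distrib_left[symmetric])
qed

text \<open>Sudakov's inequality for an arbitrary integrable majorant \<open>\<Phi>\<close> of the process, by the free
energy argument: \<open>\<psi> t\<close> stays below \<open>\<Lambda> + t L\<close>, while an expected collision
probability \<open>Q\<close> that is small forces growth through the variance and one that is large
forces it through the entropy.\<close>

lemma sudakov_minoration_integral:
  assumes "2 \<le> card A" and "0 \<le> \<epsilon>"
    and sep: "\<And>u w. u \<in> A \<Longrightarrow> w \<in> A \<Longrightarrow> u \<noteq> w \<Longrightarrow> \<epsilon> \<le> norm (u - w)"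
    and \<Phi>: "integrable std_gaussian \<Phi>" and dom: "\<And>u g. u \<in> A \<Longrightarrow> u \<bullet> g \<le> \<Phi> g"
  shows "\<epsilon> / sqrt (2 * ln (card A)) * (ln (card A) - ln 2) \<le> (\<integral>g. \<Phi> g \<partial>std_gaussian)"
proof -
  define L where "L = (\<integral>g. \<Phi> g \<partial>std_gaussian)"
  define \<Lambda> where "\<Lambda> = ln (real (card A))"
  have \<Lambda>2: "ln 2 \<le> \<Lambda>" using assms(1) by (simp add: \<Lambda>_def)
  then have \<Lambda>: "0 < \<Lambda>" using ln_gt_zero[of "2::real"] by linarith
  define a where "a = \<epsilon>\<^sup>2 / (2 * \<Lambda>)"
  have a: "0 \<le> a" using \<Lambda> by (simp add: a_def)
  define \<psi> where "\<psi> t = (\<integral>g. ln (partition_fn A t g) \<partial>std_gaussian)" for t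
  define D where "D t = (\<integral>g. (\<Sum>u\<in>A. gibbs A t g u * (u \<bullet> g)) \<partial>std_gaussian)" for t
  define Q where "Q t = (\<integral>g. (\<Sum>u\<in>A. (gibbs A t g u)\<^sup>2) \<partial>std_gaussian)" for t
  have Q_int: "integrable std_gaussian (\<lambda>g. \<Sum>u\<in>A. (gibbs A t g u)\<^sup>2)" for t
    unfolding power2_eq_square
    using gibbs_le_1[OF fin ne] gibbs_pos[OF fin ne]
    by (intro integrable_gibbs_mean integrable_const_bound[where B = 1]) (auto simp: abs_of_pos)
  have D_int: "integrable std_gaussian (\<lambda>g. \<Sum>u\<in>A. gibbs A t g u * (u \<bullet> g))" for t
    by (intro integrable_gibbs_mean integrable_gaussian_inner)
  have D_ge: "t * (\<epsilon>\<^sup>2 / 2 * (1 - Q t)) \<le> D t" if "0 \<le> t" for t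
  proof -
    let ?V = "\<lambda>g. \<Sum>u\<in>A. gibbs A t g u * (u \<bullet> u - (\<Sum>w\<in>A. gibbs A t g w * (w \<bullet> u)))"
    have "integrable std_gaussian ?V"
      by (intro integrable_gibbs_mean Bochner_Integration.integrable_diff integrable_const)
    then have "(\<integral>g. \<epsilon>\<^sup>2 / 2 * (1 - (\<Sum>u\<in>A. (gibbs A t g u)\<^sup>2)) \<partial>std_gaussian)
        \<le> (\<integral>g. ?V g \<partial>std_gaussian)"
      using gibbs_variance_ge_collision[OF fin ne \<open>0 \<le> \<epsilon>\<close> sep] Q_int
      by (intro integral_mono) auto
    then have "\<epsilon>\<^sup>2 / 2 * (1 - Q t) \<le> (\<integral>g. ?V g \<partial>std_gaussian)"
      using Q_int by (simp add: Q_def)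
    then show ?thesis
      unfolding D_def gaussian_gibbs_mean_eq by (intro mult_left_mono that)
  qed
  have \<psi>_le_Q: "\<psi> t - t * D t \<le> ln 2 + (1 - Q t) * \<Lambda>" for t
  proof -
    have "(\<integral>g. ln (partition_fn A t g) - t * (\<Sum>u\<in>A. gibbs A t g u * (u \<bullet> g)) \<partial>std_gaussian)
        \<le> (\<integral>g. ln 2 + (1 - (\<Sum>u\<in>A. (gibbs A t g u)\<^sup>2)) * \<Lambda> \<partial>std_gaussian)"
      unfolding \<Lambda>_def using free_energy_le_collision[OF fin ne] D_int Q_int integrable_ln_partition_fn
      by (intro integral_mono) auto
    then show ?thesis
      using D_int Q_int integrable_ln_partition_fn by (simp add: \<psi>_def D_def Q_def)
  qed
  have ineq: "a * t * ((\<psi> t - ln 2) - t * D t) \<le> D t" if "0 \<le> t" for t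
  proof -
    have "a * t * ((\<psi> t - ln 2) - t * D t) \<le> a * t * ((1 - Q t) * \<Lambda>)"
      using \<psi>_le_Q[of t] a that by (intro mult_left_mono) auto
    also have "\<dots> = t * (\<epsilon>\<^sup>2 / 2 * (1 - Q t))" using \<Lambda> by (simp add: a_def)
    also have "\<dots> \<le> D t" by (rule D_ge[OF that])
    finally show ?thesis .
  qed
  have \<psi>0: "\<psi> 0 = \<Lambda>" by (simp add: \<psi>_def partition_fn_def \<Lambda>_def)
  have lower: "(\<Lambda> - ln 2) * (sqrt a * t) \<le> \<psi> t - ln 2" if "0 \<le> t" for t
  proof -
    have "((\<lambda>t. \<psi> t - ln 2) has_real_derivative D t) (at t)" for t
      unfolding \<psi>_def D_def using DERIV_diff[OF DERIV_gaussian_free_energy DERIV_const] by simp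
    then have "(\<psi> 0 - ln 2) * sqrt (1 + a * t\<^sup>2) \<le> \<psi> t - ln 2"
      using growth_of_differential_inequality[where f = "\<lambda>t. \<psi> t - ln 2" and f' = D, OF _ ineq a that] by blast
    moreover have "sqrt a * t \<le> sqrt (1 + a * t\<^sup>2)"
      using that by (intro real_le_rsqrt) (simp add: power_mult_distrib a)
    then have "(\<Lambda> - ln 2) * (sqrt a * t) \<le> (\<Lambda> - ln 2) * sqrt (1 + a * t\<^sup>2)"
      using \<Lambda>2 by (intro mult_left_mono) auto
    ultimately show ?thesis using \<psi>0 by simp
  qed
  have upper: "\<psi> t \<le> \<Lambda> + t * L" if "0 \<le> t" for t
  proof -
    have "\<psi> t \<le> (\<integral>g. \<Lambda> + t * \<Phi> g \<partial>std_gaussian)"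
      unfolding \<psi>_def \<Lambda>_def using ln_partition_fn_le[OF fin ne that dom] \<Phi>
      by (intro integral_mono integrable_ln_partition_fn) auto
    then show ?thesis using \<Phi> by (simp add: L_def)
  qed
  have "(\<Lambda> - ln 2) * sqrt a \<le> L"
  proof (rule ccontr)
    assume "\<not> ?thesis"
    then have d: "0 < (\<Lambda> - ln 2) * sqrt a - L" by simp
    \<comment> \<open>At this \<open>t\<close> the lower bound on \<open>\<psi> t - ln 2\<close> equals the upper bound on \<open>\<psi> t\<close>.\<close>
    define t where "t = \<Lambda> / ((\<Lambda> - ln 2) * sqrt a - L)"
    have t: "0 \<le> t" using d \<Lambda> by (simp add: t_def)
    have "t * ((\<Lambda> - ln 2) * sqrt a - L) = \<Lambda>" using d by (simp add: t_def)
    then have "(\<Lambda> - ln 2) * (sqrt a * t) = \<Lambda> + t * L" by (simp add: algebra_simps)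
    moreover have "0 < ln (2::real)" by simp
    ultimately show False using lower[OF t] upper[OF t] by linarith
  qed
  moreover have "sqrt a = \<epsilon> / sqrt (2 * \<Lambda>)"
    using \<open>0 \<le> \<epsilon>\<close> by (simp add: a_def real_sqrt_divide)
  ultimately show ?thesis by (simp add: L_def \<Lambda>_def mult.commute)
qed

end

lemma sudakov_minoration:
  fixes A S :: "(real ^ 'n) set"
  assumes "A \<subseteq> S" and S: "\<And>u. u \<in> S \<Longrightarrow> norm u \<le> r"
    and A: "finite A" "2 \<le> card A" and "0 \<le> \<epsilon>"
    and sep: "\<And>u w. u \<in> A \<Longrightarrow> w \<in> A \<Longrightarrow> u \<noteq> w \<Longrightarrow> \<epsilon> \<le> norm (u - w)"
  shows "\<epsilon> / sqrt (2 * ln (card A)) * (ln (card A) - ln 2) \<le> gaussian_width S"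
proof -
  have "A \<noteq> {}" using A by auto
  then have "S \<noteq> {}" using \<open>A \<subseteq> S\<close> by auto
  show ?thesis
    unfolding gaussian_width_def
  proof (rule sudakov_minoration_integral[OF \<open>finite A\<close> \<open>A \<noteq> {}\<close> A(2) \<open>0 \<le> \<epsilon>\<close> sep])
    show "integrable std_gaussian (\<lambda>g. SUP u\<in>S. u \<bullet> g)"
      using S \<open>S \<noteq> {}\<close> by (rule integrable_gaussian_support)
    show "u \<bullet> g \<le> (SUP u\<in>S. u \<bullet> g)" if "u \<in> A" for u g
      by (rule cSUP_upper[OF _ bdd_above_support[OF S]]) (use that \<open>A \<subseteq> S\<close> in auto)
  qed
qed

section \<open>Packings of sets of fixed size\<close>

lemma binomial_ratio_le:
  assumes "m \<le> n"
  shows "(m choose k) * n ^ k \<le> (n choose k) * m ^ k"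
proof (induction k)
  case (Suc k)
  have "(m - k) * n \<le> (n - k) * m"
    using assms by (simp add: diff_mult_distrib mult.commute[of m n] diff_le_mono2)
  with Suc have "((m choose k) * n ^ k) * ((m - k) * n) \<le> ((n choose k) * m ^ k) * ((n - k) * m)"
    by (rule mult_le_mono)
  then have "Suc k * (m choose Suc k) * n ^ Suc k \<le> Suc k * (n choose Suc k) * m ^ Suc k"
    unfolding binomial_absorb_comp[symmetric] Suc_times_binomial_eq binomial_absorption
    by (simp add: binomial_absorption binomial_absorb_comp mult_ac)
  then show ?case unfolding mult.assoc Suc_mult_le_cancel1 .
qed simp

text \<open>Row \<open>m\<close> of Pascal's triangle sums to \<open>2 ^ m\<close> and contains this coefficient twice, at the
distinct positions \<open>k\<close> and \<open>m - k\<close>.\<close>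

lemma binomial_le_half_power:
  assumes "m < 2 * k"
  shows "2 * (m choose k) \<le> 2 ^ m"
proof (cases "k \<le> m")
  case True
  then have "(m choose k) + (m choose (m - k)) = (\<Sum>i\<in>{k, m - k}. m choose i)"
    using assms by simp
  also have "\<dots> \<le> (\<Sum>i\<le>m. m choose i)"
    using True by (intro sum_mono2) auto
  finally show ?thesis using True by (simp add: choose_row_sum binomial_symmetric[symmetric])
qed (simp add: binomial_eq_0)

definition packing :: "nat \<Rightarrow> 'a set set \<Rightarrow> bool" where
  "packing m F \<longleftrightarrow> (\<forall>S\<in>F. card S = m) \<and>
     (\<forall>S\<in>F. \<forall>S'\<in>F. S \<noteq> S' \<longrightarrow> 2 * card (S \<inter> S') \<le> m)"

text \<open>A packing of maximal size covers: every \<open>m\<close>-set shares at least \<open>k\<close> elements with a member of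
the packing, hence contains one of its \<open>k\<close>-subsets. Counting the \<open>m\<close>-sets that contain a
given \<open>k\<close>-set gives the inequality.\<close>

lemma ex_packing:
  assumes "0 < m" "m \<le> CARD('a::finite)" and k: "k = m div 2 + 1"
  obtains F :: "'a::finite set set" where "packing m F"
    and "CARD('a) choose k \<le> card F * (m choose k)\<^sup>2"
proof -
  let ?n = "CARD('a)"
  have "packing m ({} :: 'a set set)" by (simp add: packing_def)
  moreover have "\<forall>F :: 'a set set. packing m F \<longrightarrow> card F < Suc (card (UNIV :: 'a set set))"
    by (intro allI impI le_imp_less_Suc card_mono) auto
  ultimately have "\<exists>F :: 'a set set. packing m F \<and> (\<forall>F' :: 'a set set. packing m F' \<longrightarrow> card F' \<le> card F)"
    by (rule ex_has_greatest_nat)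
  then obtain F :: "'a set set" where F: "packing m F"
    and max: "\<And>F' :: 'a set set. packing m F' \<Longrightarrow> card F' \<le> card F"
    by blast
  have "k \<le> m" using \<open>0 < m\<close> k by linarith
  have cover: "\<exists>S\<in>F. k \<le> card (S \<inter> S')" if S': "card S' = m" for S'
  proof (rule ccontr)
    assume "\<not> ?thesis"
    then have *: "card (S \<inter> S') < k" if "S \<in> F" for S using that by force
    then have "S' \<notin> F" using S' \<open>k \<le> m\<close> by force
    have "2 * card (S \<inter> S') \<le> m" "2 * card (S' \<inter> S) \<le> m" if "S \<in> F" for S
      using *[OF that] k by (auto simp: Int_commute)
    then have "packing m (insert S' F)"
      using F S' by (auto simp: packing_def)
    from max[OF this] \<open>S' \<notin> F\<close> show False by simp
  qed
  define near where "near R = {S' :: 'a set. R \<subseteq> S' \<and> card S' = m}" for R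
  have card_near: "card (near R) = (?n - k) choose (m - k)" if "card R = k" for R
  proof -
    have "bij_betw (\<lambda>X. X \<union> R) {X. X \<subseteq> - R \<and> card X = m - k} (near R)"
    proof (rule bij_betwI[where g = "\<lambda>X. X - R"])
      show "(\<lambda>X. X \<union> R) \<in> {X. X \<subseteq> - R \<and> card X = m - k} \<rightarrow> near R"
        using that \<open>k \<le> m\<close> by (auto simp: near_def card_Un_disjoint Int_commute disjoint_eq_subset_Compl)
      show "(\<lambda>X. X - R) \<in> near R \<rightarrow> {X. X \<subseteq> - R \<and> card X = m - k}"
        using that by (auto simp: near_def card_Diff_subset)
    qed (auto simp: near_def)
    then have "card (near R) = card {X. X \<subseteq> - R \<and> card X = m - k}"
      by (simp add: bij_betw_same_card)
    also have "\<dots> = (?n - k) choose (m - k)"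
      by (simp add: n_subsets Compl_eq_Diff_UNIV card_Diff_subset that)
    finally show ?thesis .
  qed
  have "{S' :: 'a set. card S' = m} \<subseteq> (\<Union>S\<in>F. \<Union>R\<in>{R. R \<subseteq> S \<and> card R = k}. near R)"
  proof
    fix S' :: "'a set" assume "S' \<in> {S'. card S' = m}"
    then have S': "card S' = m" by simp
    from cover[OF S'] obtain S where "S \<in> F" "k \<le> card (S \<inter> S')" by blast
    then obtain R where "R \<subseteq> S \<inter> S'" "card R = k" by (meson obtain_subset_with_card_n)
    then show "S' \<in> (\<Union>S\<in>F. \<Union>R\<in>{R. R \<subseteq> S \<and> card R = k}. near R)"
      using \<open>S \<in> F\<close> S' by (auto simp: near_def)
  qed
  then have "card {S' :: 'a set. card S' = m} \<le> card (\<Union>S\<in>F. \<Union>R\<in>{R. R \<subseteq> S \<and> card R = k}. near R)"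
    by (intro card_mono) auto
  also have "\<dots> \<le> (\<Sum>S\<in>F. card (\<Union>R\<in>{R. R \<subseteq> S \<and> card R = k}. near R))"
    by (rule card_UN_le) simp
  also have "\<dots> \<le> (\<Sum>S\<in>F. (m choose k) * ((?n - k) choose (m - k)))"
  proof (rule sum_mono)
    fix S assume "S \<in> F"
    have "card (\<Union>R\<in>{R. R \<subseteq> S \<and> card R = k}. near R) \<le> (\<Sum>R\<in>{R. R \<subseteq> S \<and> card R = k}. card (near R))"
      by (rule card_UN_le) simp
    also have "\<dots> = card {R. R \<subseteq> S \<and> card R = k} * ((?n - k) choose (m - k))"
      using card_near by simp
    also have "card {R. R \<subseteq> S \<and> card R = k} = m choose k"
      using F \<open>S \<in> F\<close> by (simp add: n_subsets packing_def)
    finally show "card (\<Union>R\<in>{R. R \<subseteq> S \<and> card R = k}. near R)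
      \<le> (m choose k) * ((?n - k) choose (m - k))" .
  qed
  finally have le: "?n choose m \<le> card F * ((m choose k) * ((?n - k) choose (m - k)))"
    using n_subsets[of "UNIV :: 'a set" m] by simp
  have "(?n choose k) * ((?n - k) choose (m - k)) = (?n choose m) * (m choose k)"
    by (rule choose_mult[OF \<open>k \<le> m\<close> \<open>m \<le> ?n\<close>, symmetric])
  also have "\<dots> \<le> card F * ((m choose k) * ((?n - k) choose (m - k))) * (m choose k)"
    using le by (rule mult_le_mono1)
  also have "\<dots> = (card F * (m choose k)\<^sup>2) * ((?n - k) choose (m - k))"
    by (simp add: power2_eq_square mult_ac)
  finally have "?n choose k \<le> card F * (m choose k)\<^sup>2"
  proof (rule mult_right_le_imp_le)
    show "0 < (?n - k) choose (m - k)"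
      using \<open>m \<le> ?n\<close> by (simp add: zero_less_binomial_iff)
  qed
  with F that show thesis by blast
qed

text \<open>The packing bound gives \<open>card F \<ge> 2 (M / m)^k / 2^m\<close> with \<open>k \<ge> (m + 1) / 2\<close>. The half by
which \<open>k\<close> exceeds \<open>m / 2\<close> contributes a factor \<open>sqrt (M / m) \<ge> sqrt 5 \<ge> 2\<close>, which together
with the factor \<open>2\<close> accounts for the summand \<open>2 ln 2\<close>.\<close>

lemma ex_large_packing:
  assumes "0 < m" and five: "5 * m \<le> CARD('a::finite)"
  obtains F :: "'a::finite set set" where "packing m F"
    and "2 * ln 2 + m / 2 * ln (CARD('a) / (5 * real m)) \<le> ln (card F)"
    and "0 < card F"
proof -
  define k where "k = m div 2 + 1"
  let ?n = "CARD('a)"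
  have km: "k \<le> m" "m < 2 * k" using \<open>0 < m\<close> unfolding k_def by presburger+
  have km': "real m + 1 \<le> 2 * real k"
    using of_nat_mono[of "m + 1" "2 * k", where 'a = real] km(2) by simp
  have "m \<le> ?n" using five by simp
  then obtain F :: "'a set set" where F: "packing m F"
    and cF: "?n choose k \<le> card F * (m choose k)\<^sup>2"
    using ex_packing[OF \<open>0 < m\<close> _ k_def] by blast
  let ?b = "m choose k"
  have b: "0 < ?b" using km by (simp add: zero_less_binomial_iff)
  have "?b * ?n ^ k \<le> (?n choose k) * m ^ k" using five by (intro binomial_ratio_le) simp
  also have "\<dots> \<le> card F * ?b\<^sup>2 * m ^ k" using cF by (rule mult_le_mono1)
  finally have "?b * ?n ^ k \<le> ?b * (card F * ?b * m ^ k)" by (simp add: power2_eq_square mult_ac)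
  then have "?n ^ k \<le> card F * ?b * m ^ k" using b by simp
  then have "2 * ?n ^ k \<le> card F * (2 * ?b) * m ^ k" by simp
  also have "\<dots> \<le> card F * 2 ^ m * m ^ k"
    by (intro mult_le_mono binomial_le_half_power km order_refl)
  finally have le: "2 * ?n ^ k \<le> card F * 2 ^ m * m ^ k" .
  moreover have "0 < 2 * ?n ^ k" by simp
  ultimately have cF0: "0 < card F" by (cases "card F = 0") auto
  have "ln (real (2 * ?n ^ k)) \<le> ln (real (card F * 2 ^ m * m ^ k))"
    using le by (subst ln_le_cancel_iff) (use cF0 \<open>0 < m\<close> in \<open>auto simp del: of_nat_mult of_nat_power\<close>)
  then have *: "ln 2 + k * ln ?n \<le> ln (card F) + m * ln 2 + k * ln m"
    using cF0 card_gt_0_iff[of F] \<open>0 < m\<close> by (simp add: ln_mult ln_realpow)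
  define l where "l = ln (?n / (5 * real m))"
  have l: "ln (real ?n) = l + ln 5 + ln m"
    using \<open>0 < m\<close> by (simp add: l_def ln_div ln_mult)
  have "0 \<le> l" using five \<open>0 < m\<close> by (simp add: l_def field_simps)
  have "ln (4::real) \<le> ln 5" by simp
  moreover have "ln (4::real) = 2 * ln 2" using ln_realpow[of "2::real" 2] by simp
  ultimately have ln5: "2 * ln 2 \<le> ln (5::real)" by simp
  have "(real m + 1) / 2 * (l + ln 5) \<le> k * (l + ln 5)"
    using km' \<open>0 \<le> l\<close> by (intro mult_right_mono) auto
  moreover have "ln 2 + k * (l + ln 5) \<le> ln (card F) + m * ln 2"
    using * unfolding l by (simp add: algebra_simps)
  ultimately have "ln 2 + (real m + 1) / 2 * (l + ln 5) \<le> ln (card F) + m * ln 2"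
    by linarith
  moreover have "(real m + 1) / 2 * (2 * ln 2) \<le> (real m + 1) / 2 * ln 5"
    using ln5 by (intro mult_left_mono) auto
  ultimately have "2 * ln 2 + m / 2 * l \<le> ln (card F)"
    using \<open>0 \<le> l\<close> by (simp add: algebra_simps) (simp add: field_simps)
  then show thesis using that[OF F _ cF0] by (simp add: l_def)
qed

section \<open>Separated points in the convex hull\<close>

text \<open>The signs are chosen greedily so that each new vector makes a nonpositive inner product with
the sum of the previous ones.\<close>

lemma ex_signs_norm_sum_le:
  fixes \<mu> :: "'a \<Rightarrow> 'b::real_inner"
  assumes "finite S"
  shows "\<exists>\<sigma>. (\<forall>j. \<bar>\<sigma> j\<bar> = (1::real)) \<and> (norm (\<Sum>j\<in>S. \<sigma> j *\<^sub>R \<mu> j))\<^sup>2 \<le> (\<Sum>j\<in>S. (norm (\<mu> j))\<^sup>2)"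
  using assms
proof (induction S)
  case empty
  show ?case by (auto intro: exI[of _ "\<lambda>_. 1"])
next
  case (insert i S)
  then obtain \<sigma> :: "'a \<Rightarrow> real" where \<sigma>: "\<And>j. \<bar>\<sigma> j\<bar> = 1"
    and le: "(norm (\<Sum>j\<in>S. \<sigma> j *\<^sub>R \<mu> j))\<^sup>2 \<le> (\<Sum>j\<in>S. (norm (\<mu> j))\<^sup>2)" by blast
  let ?v = "\<Sum>j\<in>S. \<sigma> j *\<^sub>R \<mu> j"
  define c :: real where "c = (if 0 \<le> \<mu> i \<bullet> ?v then -1 else 1)"
  have c: "\<bar>c\<bar> = 1" "c * (\<mu> i \<bullet> ?v) \<le> 0" "c * c = 1" by (auto simp: c_def)
  have "(norm (c *\<^sub>R \<mu> i + ?v))\<^sup>2 = (norm (\<mu> i))\<^sup>2 + 2 * (c * (\<mu> i \<bullet> ?v)) + (norm ?v)\<^sup>2"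
    using c(3) by (simp add: power2_norm_eq_inner inner_add_left inner_add_right inner_commute algebra_simps)
  also have "\<dots> \<le> (norm (\<mu> i))\<^sup>2 + (\<Sum>j\<in>S. (norm (\<mu> j))\<^sup>2)" using c(2) le by simp
  finally have "(norm (c *\<^sub>R \<mu> i + ?v))\<^sup>2 \<le> (\<Sum>j\<in>insert i S. (norm (\<mu> j))\<^sup>2)"
    using insert by simp
  moreover have "(\<Sum>j\<in>insert i S. (\<sigma>(i := c)) j *\<^sub>R \<mu> j) = c *\<^sub>R \<mu> i + ?v"
    using insert by (simp add: if_distrib if_distribR cong: sum.cong_simp) (auto intro: sum.cong)
  ultimately show ?case
    using \<sigma> c(1) by (intro exI[of _ "\<sigma>(i := c)"]) auto
qed

lemma norm_signed_indicator_diff_ge: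
  fixes S S' :: "'k::finite set" and \<theta> \<theta>' :: "real ^ 'k"
  assumes \<theta>: "\<And>j. \<bar>\<theta> $ j\<bar> = (if j \<in> S then 1 else 0)"
    and \<theta>': "\<And>j. \<bar>\<theta>' $ j\<bar> = (if j \<in> S' then 1 else 0)"
  shows "card (S - S' \<union> (S' - S)) \<le> (norm (\<theta> - \<theta>'))\<^sup>2"
proof -
  have "1 \<le> ((\<theta> - \<theta>') $ j)\<^sup>2" if "j \<in> S - S' \<union> (S' - S)" for j
    using that \<theta>[of j] \<theta>'[of j] by (auto simp: power2_eq_1_iff abs_if split: if_splits)
  then have "(\<Sum>j\<in>S - S' \<union> (S' - S). 1) \<le> (\<Sum>j\<in>S - S' \<union> (S' - S). ((\<theta> - \<theta>') $ j)\<^sup>2)"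
    by (intro sum_mono)
  also have "\<dots> \<le> (\<Sum>j\<in>UNIV. ((\<theta> - \<theta>') $ j)\<^sup>2)"
    by (intro sum_mono2) auto
  also have "\<dots> = (norm (\<theta> - \<theta>'))\<^sup>2"
    unfolding power2_norm_eq_inner inner_vec_def by (simp add: power2_eq_square)
  finally show ?thesis by simp
qed

text \<open>The points are the averages of \<open>\<sigma> j \<mu> j\<close> over the members of the packing. With signs chosen
as above the sums have norm at most \<open>sqrt m\<close>, hence
the averages at most \<open>1 / sqrt m\<close>; the signs do not affect the separation, since indices in only one of
the two sets contribute \<open>1\<close> to the squared distance of the coefficient vectors.\<close>

lemma ex_separated_subset_of_hull:
  fixes \<mu> :: "'k::finite \<Rightarrow> real ^ 'n::finite" and F :: "'k set set"
  assumes "0 < m" and \<mu>: "\<And>j. norm (\<mu> j) = 1" and "0 < \<kappa>"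
    and lower: "\<And>\<theta> :: real ^ 'k. l0 \<theta> \<le> 2 * m \<Longrightarrow> \<kappa> * norm \<theta> \<le> norm (lin_comb \<mu> \<theta>)"
    and F: "packing m F"
  obtains A where "A \<subseteq> convex hull (range \<mu> \<union> range (\<lambda>j. - \<mu> j)) \<inter> cball 0 (1 / sqrt m)"
    and "finite A" and "card A = card F"
    and "\<And>u w. u \<in> A \<Longrightarrow> w \<in> A \<Longrightarrow> u \<noteq> w \<Longrightarrow> \<kappa> / sqrt m \<le> norm (u - w)"
proof -
  have "\<exists>\<sigma>. (\<forall>j. \<bar>\<sigma> j\<bar> = (1::real)) \<and> (norm (\<Sum>j\<in>S. \<sigma> j *\<^sub>R \<mu> j))\<^sup>2 \<le> card S" for S
    using ex_signs_norm_sum_le[of S \<mu>] by (simp add: \<mu>)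
  then obtain \<sigma> :: "'k set \<Rightarrow> 'k \<Rightarrow> real" where \<sigma>: "\<And>S j. \<bar>\<sigma> S j\<bar> = 1"
    and \<sigma>_norm: "\<And>S. (norm (\<Sum>j\<in>S. \<sigma> S j *\<^sub>R \<mu> j))\<^sup>2 \<le> card S"
    by metis
  define \<theta> :: "'k set \<Rightarrow> real ^ 'k" where "\<theta> S = (\<chi> j. if j \<in> S then \<sigma> S j else 0)" for S
  define u where "u S = (1 / m) *\<^sub>R lin_comb \<mu> (\<theta> S)" for S
  have comb: "lin_comb \<mu> (\<theta> S) = (\<Sum>j\<in>S. \<sigma> S j *\<^sub>R \<mu> j)" for S
    unfolding lin_comb_def \<theta>_def by (intro sum.mono_neutral_cong_right) auto
  have hull: "u S \<in> convex hull (range \<mu> \<union> range (\<lambda>j. - \<mu> j))" (is "_ \<in> ?T") if "S \<in> F" for S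
  proof -
    have "card S = m" using F that by (simp add: packing_def)
    have "(\<Sum>j\<in>S. (1 / m) *\<^sub>R (\<sigma> S j *\<^sub>R \<mu> j)) \<in> ?T"
    proof (rule convex_sum)
      show "\<sigma> S j *\<^sub>R \<mu> j \<in> ?T" for j
        using \<sigma>[of S j] by (intro hull_inc) (auto simp: abs_if split: if_splits)
    qed (use \<open>card S = m\<close> \<open>0 < m\<close> in auto)
    then show ?thesis by (simp add: u_def comb scaleR_sum_right)
  qed
  have norm_u: "norm (u S) \<le> 1 / sqrt m" if "S \<in> F" for S
  proof -
    have "card S = m" using F that by (simp add: packing_def)
    then have "norm (lin_comb \<mu> (\<theta> S)) \<le> sqrt m"
      using \<sigma>_norm[of S] by (intro real_le_rsqrt) (simp add: comb)
    then have "norm (u S) \<le> sqrt m / m" by (simp add: u_def divide_right_mono)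
    also have "\<dots> = 1 / sqrt m" using \<open>0 < m\<close> by (simp add: real_div_sqrt field_simps)
    finally show ?thesis .
  qed
  have sep: "\<kappa> / sqrt m \<le> norm (u S - u S')" if S: "S \<in> F" and S': "S' \<in> F" and "S \<noteq> S'" for S S'
  proof -
    have c: "card S = m" "card S' = m" "2 * card (S \<inter> S') \<le> m"
      using F that by (auto simp: packing_def)
    have "card (S - S' \<union> (S' - S)) = (card S - card (S \<inter> S')) + (card S' - card (S \<inter> S'))"
      by (subst card_Un_disjoint) (auto simp: card_Diff_subset_Int Int_commute)
    then have "m \<le> card (S - S' \<union> (S' - S))" using c by simp
    also have "card (S - S' \<union> (S' - S)) \<le> (norm (\<theta> S - \<theta> S'))\<^sup>2"
      by (rule norm_signed_indicator_diff_ge) (auto simp: \<theta>_def \<sigma>)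
    finally have "sqrt m \<le> norm (\<theta> S - \<theta> S')" by (intro real_le_lsqrt) auto
    then have "\<kappa> * sqrt m \<le> \<kappa> * norm (\<theta> S - \<theta> S')" using \<open>0 < \<kappa>\<close> by simp
    also have "\<dots> \<le> norm (lin_comb \<mu> (\<theta> S - \<theta> S'))"
    proof (rule lower)
      have "l0 (\<theta> S - \<theta> S') \<le> card (S \<union> S')"
        unfolding l0_def by (intro card_mono) (auto simp: \<theta>_def split: if_splits)
      also have "\<dots> \<le> card S + card S'" by (rule card_Un_le)
      finally show "l0 (\<theta> S - \<theta> S') \<le> 2 * m" using c by simp
    qed
    also have "lin_comb \<mu> (\<theta> S - \<theta> S') = real m *\<^sub>R (u S - u S')"
      using \<open>0 < m\<close> by (simp add: u_def scaleR_right_diff_distrib)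
        (simp add: lin_comb_def scaleR_left_diff_distrib sum_subtractf)
    finally have "\<kappa> * sqrt m \<le> real m * norm (u S - u S')" by simp
    moreover have "real m = sqrt m * sqrt m" by simp
    ultimately have "sqrt m * \<kappa> \<le> sqrt m * (sqrt m * norm (u S - u S'))"
      by (metis mult.assoc mult.commute)
    then have "\<kappa> \<le> sqrt m * norm (u S - u S')" using \<open>0 < m\<close> by simp
    then show ?thesis using \<open>0 < m\<close> by (simp add: field_simps)
  qed
  have "inj_on u F"
  proof (rule inj_onI, rule ccontr)
    fix S S' assume "S \<in> F" "S' \<in> F" "u S = u S'" "S \<noteq> S'"
    with sep[of S S'] have "\<kappa> / sqrt m \<le> 0" by simp
    moreover have "0 < \<kappa> / sqrt m" using \<open>0 < \<kappa>\<close> \<open>0 < m\<close> by simp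
    ultimately show False by linarith
  qed
  then have "card (u ` F) = card F" by (rule card_image)
  moreover have "u ` F \<subseteq> convex hull (range \<mu> \<union> range (\<lambda>j. - \<mu> j)) \<inter> cball 0 (1 / sqrt m)"
    using hull norm_u by auto
  ultimately show thesis using that[of "u ` F"] sep by force
qed

text \<open>Here \<open>x\<close> plays the logarithm of the number of points and \<open>c = ln 2\<close>: a surplus of \<open>2 c\<close> over
\<open>y\<close> pays for the loss of \<open>c\<close>, because \<open>(x - c)\<^sup>2 \<ge> x (x - 2 c)\<close>.\<close>

lemma half_sqrt_le_minoration:
  fixes x y c :: real
  assumes "0 \<le> y" "0 < c" "y + 2 * c \<le> x"
  shows "sqrt y / 2 \<le> (x - c) / sqrt (2 * x)"
proof -
  have "x * y \<le> x * (x - 2 * c)" using assms by (intro mult_left_mono) auto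
  also have "\<dots> \<le> (x - c)\<^sup>2" by (simp add: power2_eq_square algebra_simps)
  finally have "x * y \<le> (x - c)\<^sup>2" .
  moreover have "0 \<le> x * y" using assms by (intro mult_nonneg_nonneg) linarith+
  ultimately have "x * y / 2 \<le> (x - c)\<^sup>2" by linarith
  then have "sqrt (x * y / 2) \<le> x - c" using assms by (intro real_le_lsqrt) auto
  moreover have "sqrt (x * y / 2) = sqrt y / 2 * sqrt (2 * x)"
  proof -
    have "sqrt (x * y / 2) = sqrt ((2 * x) * y / 4)" by simp
    also have "\<dots> = sqrt (2 * x) * sqrt y / sqrt 4" by (simp only: real_sqrt_mult real_sqrt_divide)
    finally show ?thesis by simp
  qed
  ultimately show ?thesis using assms by (simp add: pos_le_divide_eq)
qed

section \<open>The lower bound on the Gaussian width\<close>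

theorem proposition2:
  fixes \<mu> :: "'k::finite \<Rightarrow> real ^ 'n::finite"
    and s \<kappa> :: real
    and m :: nat
    and T :: "(real ^ 'n) set"
  assumes "CARD('k) \<ge> 2"
    and "0 < s" and "s \<le> 1"
    and "m > 0" and "real m = 1 / s\<^sup>2"
    and "real m \<le> real CARD('k) / 5"
    and "\<And>j. norm (\<mu> j) = 1"
    and "T = convex hull (range \<mu> \<union> range (\<lambda>j. - \<mu> j))"
    and "0 < \<kappa>" and "\<kappa> < 1"
    and "\<And>\<theta> :: real ^ 'k. l0 \<theta> \<le> 2 * m \<Longrightarrow> \<kappa> * norm \<theta> \<le> norm (lin_comb \<mu> \<theta>)"
  shows "gaussian_width (T \<inter> cball 0 s)
           \<ge> sqrt 2 / 4 * \<kappa> * sqrt (ln (real CARD('k) * s\<^sup>2 / 5))"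
proof -
  have "sqrt m = 1 / s" using \<open>real m = 1 / s\<^sup>2\<close> \<open>0 < s\<close> by (simp add: real_sqrt_divide)
  then have s: "s = 1 / sqrt m" using \<open>0 < s\<close> by simp
  have "5 * m \<le> CARD('k)" using \<open>real m \<le> real CARD('k) / 5\<close> by simp
  from ex_large_packing[OF \<open>0 < m\<close> this]
  obtain F :: "'k set set" where F: "packing m F"
    and card_F: "2 * ln 2 + m / 2 * ln (CARD('k) / (5 * real m)) \<le> ln (card F)" "0 < card F"
    .
  from ex_separated_subset_of_hull[OF \<open>0 < m\<close> assms(7) \<open>0 < \<kappa>\<close> assms(11) F]
  obtain A where A: "A \<subseteq> T \<inter> cball 0 s" "finite A" "card A = card F"
    and sep: "\<And>u w. u \<in> A \<Longrightarrow> w \<in> A \<Longrightarrow> u \<noteq> w \<Longrightarrow> \<kappa> * s \<le> norm (u - w)"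
    unfolding \<open>T = _\<close> s times_divide_eq_right mult_1_right by metis
  define x where "x = ln (card A)"
  define y where "y = m / 2 * ln (CARD('k) / (5 * real m))"
  have "1 \<le> CARD('k) / (5 * real m)" using \<open>5 * m \<le> CARD('k)\<close> \<open>0 < m\<close> by simp
  then have y: "0 \<le> y" unfolding y_def by (intro mult_nonneg_nonneg ln_ge_zero) auto
  have xy: "y + 2 * ln 2 \<le> x" using card_F by (simp add: x_def y_def A(3))
  have "0 < ln (2::real)" by simp
  then have "0 < x" using xy y by linarith
  then have "2 \<le> card A" using card_F(2) A(3) by (cases "card A = 1") (auto simp: x_def)
  have "real CARD('k) * s\<^sup>2 / 5 = CARD('k) / (5 * real m)" by (simp add: \<open>real m = 1 / s\<^sup>2\<close>)
  also have "ln \<dots> = 2 * s\<^sup>2 * y"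
    using \<open>0 < s\<close> by (simp add: y_def \<open>real m = 1 / s\<^sup>2\<close>)
  finally have "sqrt 2 / 4 * \<kappa> * sqrt (ln (real CARD('k) * s\<^sup>2 / 5))
      = \<kappa> * s * ((sqrt 2 * sqrt 2) / 4 * sqrt y)"
    using \<open>0 < s\<close> by (simp add: real_sqrt_mult)
  also have "\<dots> = \<kappa> * s * (sqrt y / 2)" by simp
  also have "\<dots> \<le> \<kappa> * s * ((x - ln 2) / sqrt (2 * x))"
    using \<open>0 < s\<close> \<open>0 < \<kappa>\<close> by (intro mult_left_mono half_sqrt_le_minoration y xy) auto
  also have "\<dots> = \<kappa> * s / sqrt (2 * x) * (x - ln 2)" by simp
  also have "\<dots> \<le> gaussian_width (T \<inter> cball 0 s)"
    unfolding x_def using \<open>0 < s\<close> \<open>0 < \<kappa>\<close>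
    by (intro sudakov_minoration[where r = s] A \<open>2 \<le> card A\<close> sep) auto
  finally show ?thesis .
qed

end
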